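(* Let $n\ge1$. The rank of the semigroup $\mathcal{IC}_n$ is $\mathrm{rank}\,\mathcal{IC}_n=2n$.
   Context: Let $[n]=\{1,2,\ldots,n\}$ with its usual order. $\mathcal{IC}_n$ is the monoid of all injective partial transformations $\alpha$ of $[n]$ (the empty map allowed) that are isotone ($x\le y$ implies $x\alpha\le y\alpha$ for all $x,y\in\mathrm{Dom}\,\alpha$) and order-decreasing ($x\alpha\le x$ for all $x\in \mathrm{Dom}\,\alpha$), under composition of maps. The rank of a finite semigroup $S$ is $\min\{|A|: A\subseteq S,\ \langle A\rangle=S\}$, where $\langle A\rangle$ is the subsemigroup generated by $A$ (the identity is not generated for free). *)

theory Defs
  imports "HOL-Algebra.Group"
begin

inductive_set semigroup_generate :: "('a, 'b) monoid_scheme \<Rightarrow> 'a set \<Rightarrow> 'a set"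
  for G and A where
    incl: "a \<in> A \<Longrightarrow> a \<in> semigroup_generate G A"
  | mult: "x \<in> semigroup_generate G A \<Longrightarrow> y \<in> semigroup_generate G A
      \<Longrightarrow> x \<otimes>\<^bsub>G\<^esub> y \<in> semigroup_generate G A"

(* Only the multiplication of G enters: the rank is taken as a semigroup, so the unit is not
   generated for free. For a finite carrier the finiteness condition on A is automatic. *)
definition semigroup_rank :: "('a, 'b) monoid_scheme \<Rightarrow> nat" where
  "semigroup_rank G =
     (LEAST k. \<exists>A \<subseteq> carrier G. finite A \<and> card A = k \<and> semigroup_generate G A = carrier G)"

definition partial_transformations :: "'a set \<Rightarrow> ('a \<rightharpoonup> 'a) set" where
  "partial_transformations X = {\<alpha>. dom \<alpha> \<subseteq> X \<and> ran \<alpha> \<subseteq> X}"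

definition partial_isotone :: "('a::order \<rightharpoonup> 'a) \<Rightarrow> bool" where
  "partial_isotone \<alpha> \<longleftrightarrow> (\<forall>x \<in> dom \<alpha>. \<forall>y \<in> dom \<alpha>. x \<le> y \<longrightarrow> the (\<alpha> x) \<le> the (\<alpha> y))"

definition order_decreasing :: "('a::order \<rightharpoonup> 'a) \<Rightarrow> bool" where
  "order_decreasing \<alpha> \<longleftrightarrow> (\<forall>x \<in> dom \<alpha>. the (\<alpha> x) \<le> x)"

(* Maps act on the right, so the product of f and g applies f first. *)
definition IC :: "nat \<Rightarrow> (nat \<rightharpoonup> nat) monoid" where
  "IC n = \<lparr>carrier = {\<alpha> \<in> partial_transformations {1..n}.
                        inj_on \<alpha> (dom \<alpha>) \<and> partial_isotone \<alpha> \<and> order_decreasing \<alpha>},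
           monoid.mult = (\<lambda>f g. g \<circ>\<^sub>m f),
           one = Some |` {1..n}\<rparr>"

lemma IC_carrier_iff:
  "\<alpha> \<in> carrier (IC n) \<longleftrightarrow>
     (\<forall>x a. \<alpha> x = Some a \<longrightarrow> x \<in> {1..n} \<and> a \<in> {1..n} \<and> a \<le> x) \<and>
     (\<forall>x y a. \<alpha> x = Some a \<longrightarrow> \<alpha> y = Some a \<longrightarrow> x = y) \<and>
     (\<forall>x y a b. \<alpha> x = Some a \<longrightarrow> \<alpha> y = Some b \<longrightarrow> x \<le> y \<longrightarrow> a \<le> b)"
proof -
  have 1: "\<alpha> \<in> partial_transformations {1..n} \<longleftrightarrow>
      (\<forall>x a. \<alpha> x = Some a \<longrightarrow> x \<in> {1..n} \<and> a \<in> {1..n})"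
    unfolding partial_transformations_def dom_def ran_def by fast
  have 2: "inj_on \<alpha> (dom \<alpha>) \<longleftrightarrow> (\<forall>x y a. \<alpha> x = Some a \<longrightarrow> \<alpha> y = Some a \<longrightarrow> x = y)"
    unfolding inj_on_def Ball_def by (auto simp: dom_def)
  have 3: "partial_isotone \<alpha> \<longleftrightarrow>
      (\<forall>x y a b. \<alpha> x = Some a \<longrightarrow> \<alpha> y = Some b \<longrightarrow> x \<le> y \<longrightarrow> a \<le> b)"
  proof
    assume L: "partial_isotone \<alpha>"
    show "\<forall>x y a b. \<alpha> x = Some a \<longrightarrow> \<alpha> y = Some b \<longrightarrow> x \<le> y \<longrightarrow> a \<le> b"
      using L[unfolded partial_isotone_def] by (metis domI option.sel)
  qed (auto simp: partial_isotone_def)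
  have 4: "order_decreasing \<alpha> \<longleftrightarrow> (\<forall>x a. \<alpha> x = Some a \<longrightarrow> a \<le> x)"
    unfolding order_decreasing_def Ball_def by (auto simp: dom_def)
  show ?thesis
    unfolding IC_def partial_object.simps mem_Collect_eq 1 2 3 4 by blast
qed

lemma monoid_IC: "monoid (IC n)"
proof (rule monoidI)
  fix f g assume f: "f \<in> carrier (IC n)" and g: "g \<in> carrier (IC n)"
  note F = f[unfolded IC_carrier_iff] and G = g[unfolded IC_carrier_iff]
  have "x \<in> {1..n} \<and> a \<in> {1..n} \<and> a \<le> x" if h: "(g \<circ>\<^sub>m f) x = Some a" for x a
  proof -
    obtain k where k: "f x = Some k" "g k = Some a" using h unfolding map_comp_Some_iff by blast
    have "x \<in> {1..n}" "k \<le> x" using F k(1) by blast+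
    moreover have "a \<in> {1..n}" "a \<le> k" using G k(2) by blast+
    ultimately show ?thesis by simp
  qed
  moreover have "x = y" if h: "(g \<circ>\<^sub>m f) x = Some a" "(g \<circ>\<^sub>m f) y = Some a" for x y a
  proof -
    obtain k l where "f x = Some k" "g k = Some a" "f y = Some l" "g l = Some a"
      using h unfolding map_comp_Some_iff by blast
    moreover from this have "k = l" using G by blast
    ultimately show ?thesis using F by blast
  qed
  moreover have "a \<le> b" if h: "(g \<circ>\<^sub>m f) x = Some a" "(g \<circ>\<^sub>m f) y = Some b" "x \<le> y" for x y a b
  proof -
    obtain k l where "f x = Some k" "g k = Some a" "f y = Some l" "g l = Some b"
      using h unfolding map_comp_Some_iff by blast
    moreover from this have "k \<le> l" using F h(3) by blast
    ultimately show ?thesis using G by blast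
  qed
  ultimately have "g \<circ>\<^sub>m f \<in> carrier (IC n)"
    unfolding IC_carrier_iff by blast
  then show "f \<otimes>\<^bsub>IC n\<^esub> g \<in> carrier (IC n)" by (simp add: IC_def)
next
  show "\<one>\<^bsub>IC n\<^esub> \<in> carrier (IC n)"
    unfolding IC_carrier_iff by (auto simp: IC_def restrict_map_def split: if_splits)
next
  fix f g h
  show "f \<otimes>\<^bsub>IC n\<^esub> g \<otimes>\<^bsub>IC n\<^esub> h = f \<otimes>\<^bsub>IC n\<^esub> (g \<otimes>\<^bsub>IC n\<^esub> h)"
    by (auto simp: IC_def map_comp_def split: option.splits)
next
  fix f assume f: "f \<in> carrier (IC n)"
  show "\<one>\<^bsub>IC n\<^esub> \<otimes>\<^bsub>IC n\<^esub> f = f"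
  proof
    fix x show "(\<one>\<^bsub>IC n\<^esub> \<otimes>\<^bsub>IC n\<^esub> f) x = f x"
      using f unfolding IC_carrier_iff
      by (cases "f x") (auto simp: IC_def map_comp_def restrict_map_def)
  qed
  show "f \<otimes>\<^bsub>IC n\<^esub> \<one>\<^bsub>IC n\<^esub> = f"
  proof
    fix x show "(f \<otimes>\<^bsub>IC n\<^esub> \<one>\<^bsub>IC n\<^esub>) x = f x"
      using f unfolding IC_carrier_iff
      by (cases "f x") (auto simp: IC_def map_comp_def restrict_map_def)
  qed
qed

lemma finite_IC: "finite (carrier (IC n))"
proof (rule finite_subset)
  show "carrier (IC n) \<subseteq> (\<Union>D \<in> Pow {1..n}. {\<alpha>. dom \<alpha> = D \<and> ran \<alpha> \<subseteq> {1..n}})"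
    by (auto simp: IC_def partial_transformations_def)
  show "finite (\<Union>D \<in> Pow {1..n}. {\<alpha>. dom \<alpha> = D \<and> ran \<alpha> \<subseteq> {1..n}})"
    by (intro finite_UN_I finite_set_of_finite_maps) (auto intro: finite_subset)
qed

end

theory Submission
  imports Defs
begin

text \<open>
  The monoid has a smallest generating set: its irreducible elements, those that are not a product
  of two factors both different from them. These are the identity, the \<open>n\<close> partial identities
  omitting one point, and the \<open>n - 1\<close> maps that move a single point \<open>i\<close> to \<open>i - 1\<close>, are
  undefined at \<open>i - 1\<close> and fix the other points. They generate: if \<open>\<alpha>\<close> is not a partial identity
  and \<open>x\<close> is its least non-fixed point, then \<open>x - 1\<close> is outside the domain, so \<open>\<alpha>\<close> factors as the
  map moving \<open>x\<close> to \<open>x - 1\<close> followed by a map with a domain of smaller sum.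
\<close>

section \<open>Irreducible elements and rank in an arbitrary semigroup\<close>

text \<open>By induction on the generation: when \<open>e\<close> arises as a product of two
  generated elements, one factor is again \<open>e\<close>, so the induction hypothesis for that
  factor applies.\<close>

lemma irreducible_in_generators:
  assumes "e \<in> semigroup_generate G A" "semigroup_generate G A \<subseteq> carrier G"
    and "\<And>x y. x \<in> carrier G \<Longrightarrow> y \<in> carrier G \<Longrightarrow> x \<otimes>\<^bsub>G\<^esub> y = e \<Longrightarrow> x = e \<or> y = e"
  shows "e \<in> A"
proof -
  have "z = e \<longrightarrow> e \<in> A" if "z \<in> semigroup_generate G A" for z
    using that
  proof induction
    case (mult x y)
    then show ?case using assms(2,3) by blast
  qed blast
  then show ?thesis using assms(1) by blast
qed

text \<open>Every generating set contains all irreducible elements, hence \<open>T\<close>; so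
  \<open>T\<close> is the least generating set, not just one of minimal size.\<close>

lemma semigroup_rank_irreducible_generators:
  assumes "T \<subseteq> carrier G" "finite T" "semigroup_generate G T = carrier G"
    and "\<And>e x y. e \<in> T \<Longrightarrow> x \<in> carrier G \<Longrightarrow> y \<in> carrier G \<Longrightarrow> x \<otimes>\<^bsub>G\<^esub> y = e
      \<Longrightarrow> x = e \<or> y = e"
  shows "semigroup_rank G = card T"
  unfolding semigroup_rank_def
proof (rule Least_equality)
  show "\<exists>A\<subseteq>carrier G. finite A \<and> card A = card T \<and> semigroup_generate G A = carrier G"
    using assms by blast
next
  fix k
  assume "\<exists>A\<subseteq>carrier G. finite A \<and> card A = k \<and> semigroup_generate G A = carrier G"
  then obtain A where A: "finite A" "card A = k" "semigroup_generate G A = carrier G"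
    by blast
  have "T \<subseteq> A"
  proof
    fix e assume "e \<in> T"
    then show "e \<in> A"
      using irreducible_in_generators[of e G A] assms(1,4) A(3) by blast
  qed
  then show "card T \<le> k" using A card_mono by blast
qed

lemma (in monoid) semigroup_generate_subset_carrier:
  assumes "A \<subseteq> carrier G"
  shows "semigroup_generate G A \<subseteq> carrier G"
proof
  fix x assume "x \<in> semigroup_generate G A"
  then show "x \<in> carrier G" by induction (use assms in auto)
qed

section \<open>The generators and their number\<close>

definition omit :: "nat \<Rightarrow> nat \<Rightarrow> (nat \<rightharpoonup> nat)" where
  "omit n i = (Some |` {1..n})(i := None)"

text \<open>Meant for \<open>i\<close> in \<open>{2..n}\<close>: at \<open>i = 1\<close> the value
  \<open>i - 1\<close> is 0, which lies outside \<open>{1..n}\<close>.\<close>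

definition shift :: "nat \<Rightarrow> nat \<Rightarrow> (nat \<rightharpoonup> nat)" where
  "shift n i = (Some |` {1..n})(i - 1 := None, i := Some (i - 1))"

definition IC_generators :: "nat \<Rightarrow> (nat \<rightharpoonup> nat) set" where
  "IC_generators n = insert (Some |` {1..n}) (omit n ` {1..n} \<union> shift n ` {2..n})"

lemma mult_IC: "f \<otimes>\<^bsub>IC n\<^esub> g = g \<circ>\<^sub>m f"
  by (simp add: IC_def)

lemma IC_range:
  assumes "f \<in> carrier (IC n)" "f x = Some a"
  shows "1 \<le> x" "x \<le> n" "1 \<le> a" "a \<le> x"
  using assms unfolding IC_carrier_iff by auto

lemma IC_inj:
  assumes "f \<in> carrier (IC n)" "f x = Some a" "f y = Some a"
  shows "x = y"
  using assms unfolding IC_carrier_iff by blast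

lemma IC_mono:
  assumes "f \<in> carrier (IC n)" "f x = Some a" "f y = Some b" "x \<le> y"
  shows "a \<le> b"
  using assms unfolding IC_carrier_iff by blast

lemma IC_outside: "f \<in> carrier (IC n) \<Longrightarrow> x \<notin> {1..n} \<Longrightarrow> f x = None"
  by (metis IC_range(1,2) atLeastAtMost_iff not_Some_eq)

lemma IC_generators_subset: "IC_generators n \<subseteq> carrier (IC n)"
proof -
  have "Some |` {1..n} \<in> carrier (IC n)"
    unfolding IC_carrier_iff by (auto simp: restrict_map_def split: if_splits)
  moreover have "omit n i \<in> carrier (IC n)" for i
    unfolding IC_carrier_iff by (auto simp: omit_def restrict_map_def split: if_splits)
  moreover have "shift n i \<in> carrier (IC n)" if "i \<in> {2..n}" for i
    unfolding IC_carrier_iff using that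
    by (auto simp: shift_def restrict_map_def split: if_splits)
  ultimately show ?thesis by (auto simp: IC_generators_def)
qed

text \<open>The index can be read off from each map: \<open>omit n i\<close> is undefined only at
  \<open>i\<close> within \<open>{1..n}\<close>, and \<open>shift n i\<close> lowers only
  \<open>i\<close>. The count is 1 + n + (n - 1).\<close>

lemma card_IC_generators:
  assumes "n \<ge> 1"
  shows "card (IC_generators n) = 2 * n"
proof -
  let ?I = "Some |` {1..n} :: nat \<rightharpoonup> nat"
  have o: "omit n i j = None \<longleftrightarrow> j = i" if "j \<in> {1..n}" for i j
    using that by (auto simp: omit_def restrict_map_def)
  have s: "shift n i j = Some (j - 1) \<longleftrightarrow> j = i" if "i \<in> {2..n}" "j \<in> {2..n}" for i j
    using that by (auto simp: shift_def restrict_map_def split: if_splits)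
  have "inj_on (omit n) {1..n}"
    by (rule inj_onI) (metis o)
  moreover have "inj_on (shift n) {2..n}"
    by (rule inj_onI) (metis s)
  moreover have "omit n i \<noteq> shift n j" if "j \<in> {2..n}" for i j
  proof
    assume "omit n i = shift n j"
    then have "omit n i j = Some (j - 1)" using s that by metis
    then show False using that by (auto simp: omit_def restrict_map_def split: if_splits)
  qed
  then have "omit n ` {1..n} \<inter> shift n ` {2..n} = {}" by blast
  moreover have "?I \<noteq> omit n i" if "i \<in> {1..n}" for i
    using o[OF that, of i] that by (metis option.distinct(1) restrict_in)
  moreover have "?I \<noteq> shift n i" if "i \<in> {2..n}" for i
  proof
    assume "?I = shift n i"
    then have "?I i = Some (i - 1)" using s[OF that that] by metis
    then show False using that by auto
  qed
  ultimately have "?I \<notin> omit n ` {1..n} \<union> shift n ` {2..n}"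
      and "card (omit n ` {1..n} \<union> shift n ` {2..n}) = n + (n - 1)"
    by (blast, simp add: card_Un_disjoint card_image)
  then show ?thesis
    unfolding IC_generators_def using assms by simp
qed

section \<open>Irreducibility of the generators\<close>

text \<open>Both factors are order-decreasing, so the intermediate point \<open>k\<close> satisfies
  z \<le> k \<le> z.\<close>

lemma IC_mult_fixed:
  assumes "f \<in> carrier (IC n)" "g \<in> carrier (IC n)" "(f \<otimes>\<^bsub>IC n\<^esub> g) z = Some z"
  shows "f z = Some z" "g z = Some z"
proof -
  obtain k where k: "f z = Some k" "g k = Some z"
    using assms(3) by (auto simp: mult_IC map_comp_Some_iff)
  have "k = z" using IC_range(4)[OF assms(1) k(1)] IC_range(4)[OF assms(2) k(2)] by simp
  then show "f z = Some z" "g z = Some z" using k by simp_all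
qed

text \<open>Only the value at \<open>i - 1\<close> is left open, and injectivity rules out any: an
  image \<open>m\<close> would be at most \<open>i - 1\<close>, but \<open>i - 1\<close> is already
  the image of \<open>i\<close>, and a smaller \<open>m\<close> is its own image.\<close>

lemma IC_eq_shift:
  assumes f: "f \<in> carrier (IC n)" and i: "i \<in> {2..n}" and fi: "f i = Some (i - 1)"
    and fixed: "\<And>z. z \<in> {1..n} \<Longrightarrow> z \<noteq> i \<Longrightarrow> z \<noteq> i - 1 \<Longrightarrow> f z = Some z"
  shows "f = shift n i"
proof -
  have "f (i - 1) = None"
  proof (rule ccontr)
    assume "f (i - 1) \<noteq> None"
    then obtain m where m: "f (i - 1) = Some m" by blast
    note r = IC_range[OF f m]
    show False
    proof (cases "m = i - 1")
      case True
      then show False using IC_inj[OF f fi, of "i - 1"] m i by auto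
    next
      case False
      then have "f m = Some m" using fixed[of m] r by auto
      then show False using IC_inj[OF f m] False by auto
    qed
  qed
  then show ?thesis
    using fi fixed IC_outside[OF f] i
    by (auto simp: fun_eq_iff shift_def restrict_map_def)
qed

text \<open>Both factors fix every fixed point of the product, so they can differ from
  \<open>e\<close> only at \<open>i\<close>, or at \<open>i\<close> and \<open>i - 1\<close>. The
  path of \<open>i\<close> through the two factors decides which of them equals
  \<open>e\<close>.\<close>

lemma IC_generators_irreducible:
  assumes e: "e \<in> IC_generators n" and f: "f \<in> carrier (IC n)" and g: "g \<in> carrier (IC n)"
    and fg: "f \<otimes>\<^bsub>IC n\<^esub> g = e"
  shows "f = e \<or> g = e"
proof -
  have fixed: "f z = Some z \<and> g z = Some z" if "e z = Some z" for z
    using IC_mult_fixed[OF f g] that fg by blast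
  consider "e = Some |` {1..n}" | i where "i \<in> {1..n}" "e = omit n i"
    | i where "i \<in> {2..n}" "e = shift n i"
    using e by (auto simp: IC_generators_def)
  then show ?thesis
  proof cases
    case 1
    have "f z = e z" for z
      using fixed[of z] IC_outside[OF f, of z] 1 by (cases "z \<in> {1..n}") auto
    then show ?thesis by blast
  next
    case (2 i)
    have fix': "f z = Some z" "g z = Some z" if "z \<in> {1..n}" "z \<noteq> i" for z
      using fixed[of z] that 2(2) by (auto simp: omit_def)
    have eqI: "h = e" if "h \<in> carrier (IC n)" "h i = None"
      "\<And>z. z \<in> {1..n} \<Longrightarrow> z \<noteq> i \<Longrightarrow> h z = Some z" for h
      using that IC_outside[OF that(1)] 2(2) by (auto simp: fun_eq_iff omit_def restrict_map_def)
    show ?thesis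
    proof (cases "f i")
      case None
      then show ?thesis using eqI f fix' by blast
    next
      case (Some k)
      \<comment> \<open>Any other \<open>k\<close> is a fixed point of \<open>f\<close> and cannot
        also be the image of \<open>i\<close>. So \<open>f\<close> fixes \<open>i\<close>, and it
        must be \<open>g\<close> that drops it.\<close>
      have "k = i"
      proof (rule ccontr)
        assume "k \<noteq> i"
        then have "f k = Some k" using fix'(1)[of k] IC_range[OF f Some] by auto
        then show False using IC_inj[OF f Some] \<open>k \<noteq> i\<close> by blast
      qed
      moreover have "(f \<otimes>\<^bsub>IC n\<^esub> g) i = None" using fg 2 by (simp add: omit_def)
      ultimately have "g i = None" using Some by (simp add: mult_IC map_comp_def)
      then show ?thesis using eqI g fix' by blast
    qed
  next
    case (3 i)
    have fix': "f z = Some z" "g z = Some z" if "z \<in> {1..n}" "z \<noteq> i" "z \<noteq> i - 1" for z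
      using fixed[of z] that 3(2) by (auto simp: shift_def)
    have "(f \<otimes>\<^bsub>IC n\<^esub> g) i = Some (i - 1)" using fg 3 by (simp add: shift_def)
    then obtain k where k: "f i = Some k" "g k = Some (i - 1)"
      by (auto simp: mult_IC map_comp_Some_iff)
    \<comment> \<open>The single step down from \<open>i\<close> is made by exactly one factor: by
      \<open>f\<close> if \<open>k = i - 1\<close>, by \<open>g\<close> if
      \<open>k = i\<close>.\<close>
    have "k = i - 1 \<or> k = i" using IC_range[OF f k(1)] IC_range[OF g k(2)] by linarith
    then show ?thesis
      using IC_eq_shift[OF f 3(1)] IC_eq_shift[OF g 3(1)] k fix' 3(2) by blast
  qed
qed

section \<open>Generation of all elements\<close>

text \<open>Points outside \<open>D\<close> are removed one at a time by multiplying with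
  \<open>omit n i\<close>. The induction starts at the full identity, which is itself a
  generator.\<close>

lemma partial_identity_generated:
  assumes "D \<subseteq> {1..n}"
  shows "Some |` D \<in> semigroup_generate (IC n) (IC_generators n)"
proof -
  have "finite E \<Longrightarrow> E \<subseteq> {1..n} \<Longrightarrow>
      Some |` ({1..n} - E) \<in> semigroup_generate (IC n) (IC_generators n)" for E
  proof (induction E rule: finite_induct)
    case empty
    then show ?case
      by (auto intro!: semigroup_generate.incl simp: IC_generators_def)
  next
    case (insert i E)
    have "omit n i \<in> semigroup_generate (IC n) (IC_generators n)"
      using insert.prems by (auto intro!: semigroup_generate.incl simp: IC_generators_def)
    then have "Some |` ({1..n} - E) \<otimes>\<^bsub>IC n\<^esub> omit n i
        \<in> semigroup_generate (IC n) (IC_generators n)"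
      using insert by (auto intro: semigroup_generate.mult)
    moreover have "Some |` ({1..n} - E) \<otimes>\<^bsub>IC n\<^esub> omit n i = Some |` ({1..n} - insert i E)"
      by (auto simp: mult_IC fun_eq_iff map_comp_def omit_def restrict_map_def)
    ultimately show ?case by simp
  qed
  from this[of "{1..n} - D"] show ?thesis
    using assms by (simp add: double_diff)
qed

text \<open>\<open>\<beta>\<close> hands the value \<open>y\<close> from \<open>x\<close> over to
  \<open>x - 1\<close>, which is free and still at least \<open>y\<close>.\<close>

lemma IC_factor_shift:
  assumes a: "\<alpha> \<in> carrier (IC n)" and x: "\<alpha> x = Some y" "y < x"
    and least: "\<And>z. z \<in> dom \<alpha> \<Longrightarrow> z < x \<Longrightarrow> \<alpha> z = Some z"
  defines "\<beta> \<equiv> \<alpha>(x := None, x - 1 := Some y)"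
  shows "x \<in> {2..n}" "x - 1 \<notin> dom \<alpha>" "\<beta> \<in> carrier (IC n)" "\<alpha> = shift n x \<otimes>\<^bsub>IC n\<^esub> \<beta>"
proof -
  note r = IC_range[OF a x(1)]
  show x2: "x \<in> {2..n}" using r x by auto
  show nd: "x - 1 \<notin> dom \<alpha>"
  proof
    assume "x - 1 \<in> dom \<alpha>"
    \<comment> \<open>By minimality of \<open>x\<close> the point \<open>x - 1\<close> would be
      fixed. Monotonicity then forces \<open>y = x - 1\<close>, against injectivity.\<close>
    then have *: "\<alpha> (x - 1) = Some (x - 1)" using least x2 by auto
    then have "x - 1 \<le> y" using IC_mono[OF a * x(1)] by simp
    then have "\<alpha> (x - 1) = Some y" using * x by simp
    from IC_inj[OF a this x(1)] show False using x2 unfolding atLeastAtMost_iff by linarith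
  qed
  have b: "\<alpha> z = Some c \<and> z \<noteq> x \<and> z \<noteq> x - 1 \<or> z = x - 1 \<and> c = y" if "\<beta> z = Some c" for z c
    using that by (auto simp: \<beta>_def split: if_splits)
  \<comment> \<open>No point lies strictly between \<open>x - 1\<close> and \<open>x\<close>, so
    every other point of the domain compares with both alike; order and injectivity carry over to
    \<open>\<beta>\<close>.\<close>
  have rest: "c \<noteq> y" "z \<le> x - 1 \<Longrightarrow> c \<le> y" "x - 1 \<le> z \<Longrightarrow> y \<le> c"
    if "\<alpha> z = Some c" "z \<noteq> x" "z \<noteq> x - 1" for z c
    using IC_inj[OF a x(1), of z] IC_mono[OF a x(1) that(1)] IC_mono[OF a that(1) x(1)] that
    by auto
  show "\<beta> \<in> carrier (IC n)"
    unfolding IC_carrier_iff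
  proof (intro conjI allI impI)
    fix z c assume "\<beta> z = Some c"
    from b[OF this] show "z \<in> {1..n}" "c \<in> {1..n}" "c \<le> z"
      using IC_range[OF a, of z c] r x x2 by auto
  next
    fix z w c assume "\<beta> z = Some c" "\<beta> w = Some c"
    from b[OF this(1)] b[OF this(2)] show "z = w"
      using IC_inj[OF a, of z c w] rest(1)[of z c] rest(1)[of w c] by (elim disjE conjE) simp_all
  next
    fix z w c d assume "\<beta> z = Some c" "\<beta> w = Some d" and zw: "z \<le> w"
    from b[OF this(1)] b[OF this(2)] show "c \<le> d"
      using IC_mono[OF a, of z c w d] rest(2)[of z c] rest(3)[of w d] zw
      by (elim disjE conjE) simp_all
  qed
  show "\<alpha> = shift n x \<otimes>\<^bsub>IC n\<^esub> \<beta>"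
  proof
    fix z
    consider "z = x" | "z = x - 1" "z \<noteq> x" | "z \<noteq> x" "z \<noteq> x - 1" by blast
    then show "\<alpha> z = (shift n x \<otimes>\<^bsub>IC n\<^esub> \<beta>) z"
    proof cases
      case 1
      then show ?thesis using x by (simp add: mult_IC map_comp_def shift_def \<beta>_def)
    next
      case 2
      then show ?thesis using nd by (auto simp: mult_IC map_comp_def shift_def)
    next
      case 3
      then show ?thesis using IC_outside[OF a, of z]
        by (cases "z \<in> {1..n}") (auto simp: mult_IC map_comp_def shift_def restrict_map_def \<beta>_def)
    qed
  qed
qed

text \<open>Each factored shift replaces \<open>x\<close> by \<open>x - 1\<close> in the domain, so
  the sum of the domain drops by one; the process ends at a partial identity.\<close>

lemma IC_generated:
  assumes "\<alpha> \<in> carrier (IC n)"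
  shows "\<alpha> \<in> semigroup_generate (IC n) (IC_generators n)"
  using assms
proof (induction "\<Sum>(dom \<alpha>)" arbitrary: \<alpha> rule: less_induct)
  case less
  note a = less.prems
  have dom: "dom \<alpha> \<subseteq> {1..n}" using IC_range(1,2)[OF a] by fastforce
  show ?case
  proof (cases "\<forall>z \<in> dom \<alpha>. \<alpha> z = Some z")
    case True
    then have "\<alpha> = Some |` dom \<alpha>"
      by (auto simp: fun_eq_iff restrict_map_def)
    then show ?thesis using partial_identity_generated[OF dom] by simp
  next
    case False
    let ?P = "\<lambda>z. z \<in> dom \<alpha> \<and> \<alpha> z \<noteq> Some z"
    define x where "x = (LEAST z. ?P z)"
    have "?P x" unfolding x_def by (rule LeastI_ex[of ?P]) (use False in blast)
    then obtain y where y: "\<alpha> x = Some y" "y \<noteq> x" by auto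
    then have "y < x" using IC_range(4)[OF a y(1)] by simp
    have least: "\<alpha> z = Some z" if "z \<in> dom \<alpha>" "z < x" for z
      using not_less_Least[of z ?P] that unfolding x_def by blast
    let ?b = "\<alpha>(x := None, x - 1 := Some y)"
    note F = IC_factor_shift[OF a y(1) \<open>y < x\<close> least]
    have fin: "finite (dom \<alpha>)" using dom finite_subset by blast
    have "dom ?b = insert (x - 1) (dom \<alpha> - {x})" by auto
    \<comment> \<open>The inserted \<open>x - 1\<close> is new to the domain, so it contributes
      exactly \<open>x - 1\<close> to the sum.\<close>
    then have "\<Sum>(dom ?b) = x - 1 + \<Sum>(dom \<alpha> - {x})"
      using fin F(2) by simp
    also have "\<dots> < \<Sum>(dom \<alpha>)"
      using sum.remove[of "dom \<alpha>" x id] fin \<open>?P x\<close> F(1) by simp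
    finally have "?b \<in> semigroup_generate (IC n) (IC_generators n)"
      using less.hyps F(3) by blast
    moreover have "shift n x \<in> semigroup_generate (IC n) (IC_generators n)"
      using F(1) by (auto intro!: semigroup_generate.incl simp: IC_generators_def)
    ultimately show ?thesis
      using F(4) semigroup_generate.mult by metis
  qed
qed

theorem corollary3p17:
  fixes n :: nat
  assumes "n \<ge> 1"
  shows "semigroup_rank (IC n) = 2 * n"
proof -
  have "semigroup_generate (IC n) (IC_generators n) = carrier (IC n)"
    using monoid.semigroup_generate_subset_carrier[OF monoid_IC IC_generators_subset]
      IC_generated by blast
  then have "semigroup_rank (IC n) = card (IC_generators n)"
    using IC_generators_subset IC_generators_irreducible
    by (intro semigroup_rank_irreducible_generators) (auto simp: IC_generators_def)
  then show ?thesis using card_IC_generators[OF assms] by simp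
qed

end
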